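(* Let $m\in\{1,2\}$, let $H_0,\dots,H_m\in\mathbb{R}^{n\times n}$ be symmetric matrices and let $G(\delta)=H_0+\sum_{i=1}^m\delta_iH_i$ for $\delta\in\mathbb{R}^m$. Then $G(\delta)\ge 0$ for all $\delta$ in the unit cube $\{\delta\in\mathbb{R}^m\mid|\delta_i|\le 1\text{ for all } i\}$ if and only if there exists a tuple $(S_0,S_1,\dots,S_m)\in\mathcal{X}_3$.
   Context: $\mathcal{X}_3$ is the set of tuples $(S_0,S_1,\dots,S_m)$ such that: $S_0$ is a symmetric $n\times n$ polynomial matrix in $\delta=(\delta_1,\dots,\delta_m)$ of total degree at most $2$ which is sum-of-squares (there exist $q$ and a polynomial matrix $T\in\mathbb{R}[\delta]^{n\times q}$ with $S_0(\delta)=T(\delta)T(\delta)^T$); $S_1,\dots,S_m\in\mathbb{R}^{n\times n}$ are constant symmetric matrices; and, identically in $\delta$, $G(\delta)=S_0(\delta)+\sum_{i=1}^m(1-\delta_i^2)S_i$. For a symmetric matrix $X$, $X\ge 0$ means positive semidefinite. *)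

theory Defs
  imports "HOL-Analysis.Analysis" "HOL-Library.Poly_Mapping"
begin

text \<open>
  Polynomials in the indeterminates \<open>\<delta>\<^sub>i\<close>, \<open>i :: 'm\<close>, are finitely supported maps from
  monomials (exponent vectors) to coefficients; the ring structure is the convolution
  structure of \<^theory>\<open>HOL-Library.Poly_Mapping\<close>. The number of indeterminates is \<open>CARD('m)\<close>.
\<close>

type_synonym 'm mpoly = "('m \<Rightarrow>\<^sub>0 nat) \<Rightarrow>\<^sub>0 real"

definition total_degree :: "'m::finite mpoly \<Rightarrow> nat" where
  "total_degree p = Max (insert 0 ((\<lambda>e. \<Sum>i\<in>UNIV. Poly_Mapping.lookup e i) ` Poly_Mapping.keys p))"

definition eval_mpoly :: "'m::finite mpoly \<Rightarrow> real ^ 'm \<Rightarrow> real" where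
  "eval_mpoly p \<delta> = (\<Sum>e\<in>Poly_Mapping.keys p. Poly_Mapping.lookup p e * (\<Prod>i\<in>UNIV. (\<delta> $ i) ^ Poly_Mapping.lookup e i))"

definition eval_mpoly_mat :: "'m::finite mpoly ^ 'n ^ 'n \<Rightarrow> real ^ 'm \<Rightarrow> real ^ 'n ^ 'n" where
  "eval_mpoly_mat P \<delta> = (\<chi> i j. eval_mpoly (P $ i $ j) \<delta>)"

definition symmetric_mat :: "'a ^ 'n ^ 'n \<Rightarrow> bool" where
  "symmetric_mat A \<longleftrightarrow> transpose A = A"

definition psd :: "real ^ 'n ^ 'n \<Rightarrow> bool" where
  "psd A \<longleftrightarrow> symmetric_mat A \<and> (\<forall>x. 0 \<le> x \<bullet> (A *v x))"

text \<open>
  \<open>S = T T\<^sup>T\<close> as an identity of polynomial matrices. The number \<open>q\<close> of columns of \<open>T\<close> is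
  existentially quantified, so it cannot be an index type; \<open>T r k\<close> is the entry in row \<open>r\<close>
  and column \<open>k < q\<close>.
\<close>

definition sos_mat :: "'m::finite mpoly ^ 'n ^ 'n \<Rightarrow> bool" where
  "sos_mat S \<longleftrightarrow>
     (\<exists>(q::nat) (T :: 'n \<Rightarrow> nat \<Rightarrow> 'm mpoly).
        \<forall>r s. S $ r $ s = (\<Sum>k<q. T r k * T s k))"

text \<open>
  The tuple \<open>(S\<^sub>0, S\<^sub>1, \<dots>, S\<^sub>m)\<close> is represented as the pair of \<open>S\<^sub>0\<close> and the family \<open>(S\<^sub>i)\<close>.
  No definiteness is imposed on the \<open>S\<^sub>i\<close>, only symmetry.
\<close>

definition X3 ::
    "(real ^ 'm::finite \<Rightarrow> real ^ 'n ^ 'n)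
      \<Rightarrow> (('m mpoly ^ 'n ^ 'n) \<times> ('m \<Rightarrow> real ^ 'n ^ 'n)) set" where
  "X3 G = {(S\<^sub>0, S).
     symmetric_mat S\<^sub>0 \<and> (\<forall>r s. total_degree (S\<^sub>0 $ r $ s) \<le> 2) \<and> sos_mat S\<^sub>0 \<and>
     (\<forall>i. symmetric_mat (S i)) \<and>
     (\<forall>\<delta>. G \<delta> = eval_mpoly_mat S\<^sub>0 \<delta> + (\<Sum>i\<in>UNIV. (1 - (\<delta> $ i)\<^sup>2) *\<^sub>R S i))}"

end

theory Submission
  imports Defs
begin

text \<open>
  The form \<open>x \<bullet> (G \<delta> *v x)\<close> is affine in \<open>\<delta>\<close>, and at a vertex \<open>G = S\<^sub>0\<close>; this gives one direction.

  For the other direction let \<open>m = 2\<close>, put \<open>u = (\<delta>\<^sub>1 + \<delta>\<^sub>2)/2\<close>, \<open>v = (\<delta>\<^sub>1 - \<delta>\<^sub>2)/2\<close> and write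
  \<open>G = H\<^sub>0 + u K + v L\<close>. Positivity at the vertices means \<open>-H\<^sub>0 \<le> K, L \<le> H\<^sub>0\<close>. Modulo the constraints
  \<open>\<delta>\<^sub>i\<^sup>2 = 1\<close> we have \<open>u\<^sup>2 + v\<^sup>2 = 1\<close> and \<open>u v = 0\<close>. If \<open>H\<^sub>0 = 1\<close> and \<open>K\<^sup>2 = L\<^sup>2 = 1\<close>, it follows that
  \<open>G \<equiv> G\<^sup>2 / 2\<close>. In general write \<open>K = E H\<^sub>0\<close>, \<open>L = F H\<^sub>0\<close>; the defects \<open>H\<^sub>0 - E H\<^sub>0 E\<^sup>T\<close> and
  \<open>H\<^sub>0 - F H\<^sub>0 F\<^sup>T\<close> are positive semidefinite, and \<open>G\<close> is congruent to one half of
  \<open>(1 + u E + v F) H\<^sub>0 (1 + u E + v F)\<^sup>T + u\<^sup>2 (H\<^sub>0 - E H\<^sub>0 E\<^sup>T) + v\<^sup>2 (H\<^sub>0 - F H\<^sub>0 F\<^sup>T)\<close>.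
  For \<open>m = 1\<close> take \<open>u = \<delta>\<^sub>1\<close>, \<open>v = 0\<close>.
\<close>

section \<open>Polynomials\<close>

definition monomial_value :: "('m::finite \<Rightarrow>\<^sub>0 nat) \<Rightarrow> real ^ 'm \<Rightarrow> real" where
  "monomial_value e \<delta> = (\<Prod>i\<in>UNIV. (\<delta> $ i) ^ Poly_Mapping.lookup e i)"

lemma monomial_value_zero [simp]: "monomial_value 0 \<delta> = 1"
  by (simp add: monomial_value_def)

lemma monomial_value_add: "monomial_value (a + b) \<delta> = monomial_value a \<delta> * monomial_value b \<delta>"
  by (simp add: monomial_value_def lookup_add power_add prod.distrib)

lemma monomial_value_single_one [simp]: "monomial_value (Poly_Mapping.single i 1) \<delta> = \<delta> $ i"
proof -
  have "monomial_value (Poly_Mapping.single i 1) \<delta> = (\<Prod>j\<in>UNIV. if i = j then \<delta> $ j else 1)"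
    unfolding monomial_value_def
    by (rule prod.cong) (auto simp: lookup_single when_def)
  then show ?thesis
    by simp
qed

text \<open>Keys outside the support contribute zero. A common index set is what makes evaluation
  additive even when cancellation shrinks the support of a sum.\<close>

lemma eval_mpoly_superset:
  assumes "finite K" "Poly_Mapping.keys p \<subseteq> K"
  shows "eval_mpoly p \<delta> = (\<Sum>e\<in>K. Poly_Mapping.lookup p e * monomial_value e \<delta>)"
  unfolding eval_mpoly_def monomial_value_def
  using assms by (intro sum.mono_neutral_left) (auto simp: in_keys_iff)

lemma eval_mpoly_zero [simp]: "eval_mpoly 0 \<delta> = 0"
  by (simp add: eval_mpoly_def)

lemma eval_mpoly_single: "eval_mpoly (Poly_Mapping.single e c) \<delta> = c * monomial_value e \<delta>"
  by (subst eval_mpoly_superset[of "{e}"]) (auto simp: keys_single)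

lemma eval_mpoly_add [simp]: "eval_mpoly (p + q) \<delta> = eval_mpoly p \<delta> + eval_mpoly q \<delta>"
proof -
  let ?K = "Poly_Mapping.keys p \<union> Poly_Mapping.keys q"
  have K: "finite ?K" "Poly_Mapping.keys (p + q) \<subseteq> ?K"
    by (auto dest: subsetD[OF keys_add])
  show ?thesis
    using K by (simp add: eval_mpoly_superset[of ?K] lookup_add algebra_simps sum.distrib)
qed

lemma eval_mpoly_sum [simp]: "eval_mpoly (\<Sum>x\<in>A. f x) \<delta> = (\<Sum>x\<in>A. eval_mpoly (f x) \<delta>)"
  by (induction A rule: infinite_finite_induct) auto

text \<open>Reduces multiplicativity of evaluation to single monomials, whose convolution just adds
  exponents.\<close>

lemma mpoly_eq_sum_singles:
  "p = (\<Sum>e\<in>Poly_Mapping.keys p. Poly_Mapping.single e (Poly_Mapping.lookup p e))"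
  by (rule poly_mapping_eqI)
     (auto simp: lookup_sum lookup_single when_def in_keys_iff sum.delta)

lemma eval_mpoly_mult [simp]: "eval_mpoly (p * q) \<delta> = eval_mpoly p \<delta> * eval_mpoly q \<delta>"
proof -
  have "eval_mpoly (p * q) \<delta> =
      eval_mpoly ((\<Sum>e\<in>Poly_Mapping.keys p. Poly_Mapping.single e (Poly_Mapping.lookup p e)) *
        (\<Sum>e\<in>Poly_Mapping.keys q. Poly_Mapping.single e (Poly_Mapping.lookup q e))) \<delta>"
    using mpoly_eq_sum_singles[of p] mpoly_eq_sum_singles[of q] by simp
  also have "\<dots> = eval_mpoly p \<delta> * eval_mpoly q \<delta>"
    by (simp add: sum_product mult_single eval_mpoly_single monomial_value_add
        eval_mpoly_superset[of "Poly_Mapping.keys p" p] eval_mpoly_superset[of "Poly_Mapping.keys q" q]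
        mult_ac)
  finally show ?thesis .
qed

section \<open>Degree bounds\<close>

lemma total_degree_le_iff:
  "total_degree p \<le> d \<longleftrightarrow>
    (\<forall>e\<in>Poly_Mapping.keys p. (\<Sum>i\<in>UNIV. Poly_Mapping.lookup e i) \<le> d)"
  by (simp add: total_degree_def)

lemma total_degree_zero_le: "total_degree 0 \<le> d"
  by (simp add: total_degree_le_iff)

lemma total_degree_add_le:
  assumes "total_degree p \<le> d" "total_degree q \<le> d"
  shows "total_degree (p + q) \<le> d"
  using assms keys_add[of p q] by (auto simp: total_degree_le_iff)

lemma total_degree_sum_le:
  assumes "\<And>x. x \<in> A \<Longrightarrow> total_degree (f x) \<le> d"
  shows "total_degree (\<Sum>x\<in>A. f x) \<le> d"
  using assms
  by (induction A rule: infinite_finite_induct) (auto simp: total_degree_zero_le intro: total_degree_add_le)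

lemma total_degree_mult_le:
  assumes "total_degree p \<le> d" "total_degree q \<le> d'"
  shows "total_degree (p * q) \<le> d + d'"
  unfolding total_degree_le_iff
proof
  fix e
  assume "e \<in> Poly_Mapping.keys (p * q)"
  then obtain a b where "e = a + b" "a \<in> Poly_Mapping.keys p" "b \<in> Poly_Mapping.keys q"
    using keys_mult[of p q] by blast
  with assms show "(\<Sum>i\<in>UNIV. Poly_Mapping.lookup e i) \<le> d + d'"
    by (auto simp: total_degree_le_iff lookup_add sum.distrib intro: add_mono)
qed

definition const_mpoly :: "real \<Rightarrow> 'm mpoly" where
  "const_mpoly c = Poly_Mapping.single 0 c"

lemma eval_const_mpoly [simp]: "eval_mpoly (const_mpoly c) \<delta> = c"
  by (simp add: const_mpoly_def eval_mpoly_single)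

lemma total_degree_const_mpoly: "total_degree (const_mpoly c) \<le> d"
  by (auto simp: total_degree_le_iff const_mpoly_def keys_single)

definition var_mpoly :: "'m \<Rightarrow> 'm mpoly" where
  "var_mpoly i = Poly_Mapping.single (Poly_Mapping.single i 1) 1"

lemma eval_var_mpoly [simp]: "eval_mpoly (var_mpoly i) \<delta> = \<delta> $ i"
  by (simp add: var_mpoly_def eval_mpoly_single del: One_nat_def)

lemma total_degree_var_mpoly: "total_degree (var_mpoly i) \<le> 1"
  by (auto simp: total_degree_le_iff var_mpoly_def lookup_single when_def)

lemma total_degree_mult_const_le:
  assumes "total_degree p \<le> d"
  shows "total_degree (p * const_mpoly c) \<le> d"
  using total_degree_mult_le[OF assms total_degree_const_mpoly[of c 0]] by simp

section \<open>Positive semidefinite matrices\<close>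

lemma inner_symmetric_mat:
  fixes A :: "real ^ 'n ^ 'n"
  assumes "symmetric_mat A"
  shows "x \<bullet> (A *v y) = (A *v x) \<bullet> y"
  using assms dot_lmul_matrix[of x A y] transpose_matrix_vector[of A x]
  by (simp add: symmetric_mat_def)

lemma symmetric_mat_add:
  fixes A B :: "real ^ 'n ^ 'n"
  assumes "symmetric_mat A" "symmetric_mat B"
  shows "symmetric_mat (A + B)"
  using assms by (simp add: symmetric_mat_def transpose_def vec_eq_iff)

lemma symmetric_mat_diff:
  fixes A B :: "real ^ 'n ^ 'n"
  assumes "symmetric_mat A" "symmetric_mat B"
  shows "symmetric_mat (A - B)"
  using assms by (simp add: symmetric_mat_def transpose_def vec_eq_iff)

lemma symmetric_mat_scaleR:
  fixes A :: "real ^ 'n ^ 'n"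
  assumes "symmetric_mat A"
  shows "symmetric_mat (c *\<^sub>R A)"
  using assms by (simp add: symmetric_mat_def transpose_def vec_eq_iff)

lemma symmetric_mat_congruence:
  fixes A :: "real ^ 'n ^ 'n"
  assumes "symmetric_mat A"
  shows "symmetric_mat (E ** A ** transpose E)"
  using assms by (simp add: symmetric_mat_def matrix_transpose_mul matrix_mul_assoc)

lemma inner_congruence:
  fixes A :: "real ^ 'n ^ 'n"
  shows "x \<bullet> ((E ** A ** transpose E) *v x) = (transpose E *v x) \<bullet> (A *v (transpose E *v x))"
  by (metis dot_lmul_matrix matrix_vector_mul_assoc transpose_matrix_vector)

lemma psd_scaleR: "psd A \<Longrightarrow> 0 \<le> c \<Longrightarrow> psd (c *\<^sub>R A)"
  by (simp add: psd_def symmetric_mat_scaleR scaleR_matrix_vector_assoc[symmetric])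

text \<open>Otherwise a small step from \<open>x\<close> along \<open>- (A *v x)\<close> makes the
  form negative: it changes by a negative term linear in the step length plus a quadratic
  one.\<close>

lemma psd_kernel:
  assumes "psd A" "x \<bullet> (A *v x) = 0"
  shows "A *v x = 0"
proof (rule ccontr)
  assume "A *v x \<noteq> 0"
  define z where "z = A *v x"
  define a where "a = z \<bullet> z"
  define c where "c = z \<bullet> (A *v z)"
  have a: "a > 0" using \<open>A *v x \<noteq> 0\<close> by (simp add: a_def z_def)
  have c: "c \<ge> 0" using assms by (simp add: c_def psd_def)
  have sym: "symmetric_mat A" using assms by (simp add: psd_def)
  \<comment> \<open>Small enough that \<open>t * c \<le> a\<close>; the \<open>+ 1\<close> covers
    \<open>c = 0\<close>.\<close>
  define t where "t = a / (c + 1)"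
  have t: "t > 0" using a c by (simp add: t_def)
  have "0 \<le> (x - t *\<^sub>R z) \<bullet> (A *v (x - t *\<^sub>R z))"
    using assms by (simp add: psd_def)
  also have "\<dots> = t * (t * c - 2 * a)"
    using assms(2) inner_symmetric_mat[OF sym, of x z]
    by (simp add: matrix_vector_mult_diff_distrib matrix_vector_mult_scaleR inner_diff_left
        inner_diff_right algebra_simps a_def c_def z_def[symmetric])
  finally have "2 * a \<le> t * c"
    using t by (simp add: zero_le_mult_iff)
  moreover have "t * c \<le> t * (c + 1)" using t by simp
  moreover have "t * (c + 1) = a" using c by (simp add: t_def)
  ultimately show False using a by linarith
qed

lemma inner_mult_axis: "axis i 1 \<bullet> ((A :: real ^ 'n ^ 'n) *v axis j 1) = A $ i $ j"
  by (simp add: inner_axis' matrix_vector_mult_basis column_def)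

lemma psd_diag_zero:
  assumes "psd A" "A $ i $ i = 0"
  shows "A $ r $ i = 0" "A $ i $ r = 0"
proof -
  have "A *v axis i 1 = 0"
    using psd_kernel[OF assms(1), of "axis i 1"] assms(2) by (simp add: inner_mult_axis)
  then show "A $ r $ i = 0" by (metis inner_mult_axis inner_zero_right)
  then show "A $ i $ r = 0"
    using assms(1) by (simp add: psd_def symmetric_mat_def transpose_def vec_eq_iff)
qed

section \<open>Gram factorization by pivoting\<close>

definition outer :: "real ^ 'n \<Rightarrow> real ^ 'n ^ 'n" where
  "outer c = (\<chi> i j. c $ i * c $ j)"

lemma outer_mult_vec: "outer c *v z = (c \<bullet> z) *\<^sub>R c"
  by (simp add: outer_def vec_eq_iff matrix_vector_mult_def inner_vec_def sum_distrib_left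
      sum_distrib_right mult_ac)

text \<open>One Cholesky step: completing the square in direction \<open>axis p 1\<close>, the
  remainder's form at \<open>z\<close> is the minimum of the form of \<open>A\<close> on the line
  through \<open>z\<close> in that direction.\<close>

lemma psd_minus_pivot:
  assumes "psd A" "A $ p $ p > 0"
  shows "psd (A - outer ((1 / sqrt (A $ p $ p)) *\<^sub>R (A *v axis p 1)))" (is "psd (A - outer ?c)")
proof -
  let ?e = "axis p 1 :: real ^ 'a"
  have sym: "symmetric_mat A" using assms by (simp add: psd_def)
  have "0 \<le> z \<bullet> ((A - outer ?c) *v z)" for z
  proof -
    \<comment> \<open>The minimizer along that line.\<close>
    define t where "t = (z \<bullet> (A *v ?e)) / A $ p $ p"
    have zc: "z \<bullet> (A *v ?e) = t * A $ p $ p" using assms by (simp add: t_def)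
    have "0 \<le> (z - t *\<^sub>R ?e) \<bullet> (A *v (z - t *\<^sub>R ?e))"
      using assms by (simp add: psd_def)
    also have "\<dots> = z \<bullet> (A *v z) - 2 * t * (z \<bullet> (A *v ?e)) + t\<^sup>2 * (?e \<bullet> (A *v ?e))"
      using inner_symmetric_mat[OF sym, of ?e z]
      by (simp add: matrix_vector_mult_diff_distrib matrix_vector_mult_scaleR inner_diff_left
          inner_diff_right algebra_simps power2_eq_square inner_commute[of "A *v ?e" z])
    also have "\<dots> = z \<bullet> (A *v z) - t\<^sup>2 * A $ p $ p"
      unfolding zc inner_mult_axis by (simp add: power2_eq_square algebra_simps)
    also have "\<dots> = z \<bullet> (A *v z) - (?c \<bullet> z)\<^sup>2"
      using assms(2) zc by (simp add: inner_commute power_divide power_mult_distrib power2_eq_square)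
    also have "\<dots> = z \<bullet> ((A - outer ?c) *v z)"
      by (simp add: matrix_vector_mult_diff_rdistrib outer_mult_vec inner_diff_right
          power2_eq_square inner_commute)
    finally show ?thesis .
  qed
  moreover have "symmetric_mat (outer ?c)"
    by (simp add: symmetric_mat_def outer_def transpose_def mult.commute)
  ultimately show ?thesis
    using sym by (simp add: psd_def symmetric_mat_diff)
qed

text \<open>Cholesky factorization without square-root matrices, by induction on the number of
  nonzero diagonal entries; if there are none, \<open>A = 0\<close> and \<open>q = 0\<close>
  works.\<close>

lemma psd_gram:
  fixes A :: "real ^ 'n ^ 'n"
  assumes "psd A"
  shows "\<exists>(q::nat) c. \<forall>i j. A $ i $ j = (\<Sum>k<q. c i k * c j k)"
  using assms
proof (induction "card {i. A $ i $ i \<noteq> 0}" arbitrary: A rule: less_induct)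
  case less
  show ?case
  proof (cases "\<exists>p. A $ p $ p \<noteq> 0")
    case False
    then have "A $ i $ j = 0" for i j using psd_diag_zero(1)[OF less.prems, of j i] by blast
    then show ?thesis by (intro exI[of _ 0]) auto
  next
    case True
    then obtain p where "A $ p $ p \<noteq> 0" by blast
    moreover have "0 \<le> A $ p $ p"
      using less.prems inner_mult_axis[of p A p] by (metis psd_def)
    ultimately have p: "A $ p $ p > 0" by simp
    define c where "c = (1 / sqrt (A $ p $ p)) *\<^sub>R (A *v axis p 1)"
    define B where "B = A - outer c"
    have psdB: "psd B"
      unfolding B_def c_def by (rule psd_minus_pivot[OF less.prems p])
    have c: "c $ i = A $ i $ p / sqrt (A $ p $ p)" for i
      by (simp add: c_def matrix_vector_mult_basis column_def)
    have B: "B $ i $ j = A $ i $ j - c $ i * c $ j" for i j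
      by (simp add: B_def outer_def)
    have "B $ p $ p = 0" using p by (simp add: B c)
    \<comment> \<open>A zero diagonal entry forces a zero row, so \<open>c $ i = 0\<close> and
      pivoting creates no new nonzero diagonal entry.\<close>
    moreover have "B $ i $ i = 0" if "A $ i $ i = 0" for i
      using psd_diag_zero[OF less.prems that] that by (simp add: B c)
    ultimately have "{i. B $ i $ i \<noteq> 0} \<subset> {i. A $ i $ i \<noteq> 0}" using p by force
    then have "card {i. B $ i $ i \<noteq> 0} < card {i. A $ i $ i \<noteq> 0}"
      by (intro psubset_card_mono) auto
    from less.hyps[OF this psdB] obtain q d
      where d: "\<And>i j. B $ i $ j = (\<Sum>k<(q::nat). d i k * d j k)" by blast
    define f where "f i k = (if k = q then c $ i else d i k)" for i k
    have "A $ i $ j = (\<Sum>k<Suc q. f i k * f j k)" for i j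
      using d[of i j] B[of i j] by (simp add: f_def)
    then show ?thesis by blast
  qed
qed

section \<open>Generalized inverses and Schur complements\<close>

lemma generalized_inverse:
  fixes A :: "real ^ 'n ^ 'm"
  shows "\<exists>B. A ** B ** A = A"
proof -
  \<comment> \<open>\<open>g\<close> chooses preimages linearly on the range of \<open>A\<close>,
    which may be singular.\<close>
  obtain g where g: "linear g" "\<And>x. A *v g (A *v x) = A *v x"
    using linear_exists_right_inverse_on[OF matrix_vector_mul_linear[of A] subspace_UNIV]
    by auto
  have "A ** matrix g ** A = A"
    using g by (simp add: matrix_eq matrix_vector_mul_assoc[symmetric] matrix_works)
  then show ?thesis by blast
qed

text \<open>The hypotheses say that the block matrix \<open>[[A, K], [K, A]]\<close> is positive semidefinite;
  \<open>E = K A\<^sup>+\<close> and \<open>A - E A E\<^sup>T\<close> is its Schur complement.\<close>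

lemma psd_pair_factor:
  fixes A K :: "real ^ 'n ^ 'n"
  assumes "psd A" "symmetric_mat K" "psd (A + K)" "psd (A - K)"
  shows "\<exists>E. E ** A = K \<and> A ** transpose E = K \<and> psd (A - E ** A ** transpose E)"
proof -
  have symA: "symmetric_mat A" using assms by (simp add: psd_def)
  \<comment> \<open>The block form is half the sum of the form of \<open>A + K\<close> at
    \<open>x + y\<close> and that of \<open>A - K\<close> at \<open>x - y\<close>.\<close>
  have block: "0 \<le> y \<bullet> (A *v y) + 2 * (y \<bullet> (K *v x)) + x \<bullet> (A *v x)" for x y
  proof -
    have "0 \<le> (x + y) \<bullet> ((A + K) *v (x + y))" "0 \<le> (x - y) \<bullet> ((A - K) *v (x - y))"
      using assms by (auto simp: psd_def)
    moreover have "(x + y) \<bullet> ((A + K) *v (x + y)) + (x - y) \<bullet> ((A - K) *v (x - y)) =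
        2 * (y \<bullet> (A *v y) + 2 * (y \<bullet> (K *v x)) + x \<bullet> (A *v x))"
      using inner_symmetric_mat[OF assms(2), of x y]
      by (simp add: matrix_vector_mult_add_rdistrib matrix_vector_mult_diff_rdistrib
          matrix_vector_right_distrib matrix_vector_mult_diff_distrib inner_add_left
          inner_add_right inner_diff_left inner_diff_right inner_commute)
    ultimately have "0 \<le> 2 * (y \<bullet> (A *v y) + 2 * (y \<bullet> (K *v x)) + x \<bullet> (A *v x))"
      by (metis add_nonneg_nonneg)
    then show ?thesis by simp
  qed
  \<comment> \<open>Taking \<open>y = x\<close> and \<open>y = -x\<close> in \<open>block\<close>
    bounds \<open>x \<bullet> (K *v x)\<close> from both sides by zero. The inclusion of kernels
    lets \<open>K\<close> factor through \<open>A\<close>.\<close>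
  have ker: "K *v x = 0" if "A *v x = 0" for x
  proof -
    have "x \<bullet> (K *v x) = 0"
      using block[of x x] block[of "-x" x] that
      by (simp add: matrix_vector_mult_diff_distrib[of _ 0, simplified])
    then show ?thesis
      using psd_kernel[OF assms(3), of x] that
      by (simp add: matrix_vector_mult_add_rdistrib)
  qed
  obtain B where B: "A ** B ** A = A" using generalized_inverse by blast
  define E where "E = K ** B"
  have EA: "E ** A = K"
  proof (subst matrix_eq, rule allI)
    fix x
    have "A *v (x - B *v (A *v x)) = 0"
      using arg_cong[OF B, of "\<lambda>M. M *v x"]
      by (simp add: matrix_vector_mult_diff_distrib matrix_vector_mul_assoc matrix_mul_assoc)
    from ker[OF this] show "E ** A *v x = K *v x"
      by (simp add: E_def matrix_vector_mult_diff_distrib matrix_vector_mul_assoc matrix_mul_assoc)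
  qed
  have AE: "A ** transpose E = K"
    using arg_cong[OF EA, of transpose] symA assms(2)
    by (simp add: matrix_transpose_mul symmetric_mat_def)
  have "0 \<le> x \<bullet> ((A - E ** A ** transpose E) *v x)" for x
  proof -
    define y where "y = transpose E *v x"
    have "K *v x = A *v y" unfolding AE[symmetric] y_def by (metis matrix_vector_mul_assoc)
    \<comment> \<open>With \<open>A *v y = K *v x\<close>, the vector \<open>-y\<close> minimizes
      the block form for fixed \<open>x\<close>.\<close>
    then have "0 \<le> x \<bullet> (A *v x) - y \<bullet> (A *v y)"
      using block[of "-y" x] by (simp add: matrix_vector_mult_diff_distrib[of _ 0, simplified])
    then show ?thesis
      by (simp add: matrix_vector_mult_diff_rdistrib inner_diff_right inner_congruence y_def)
  qed
  then have "psd (A - E ** A ** transpose E)"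
    using symA by (simp add: psd_def symmetric_mat_diff symmetric_mat_congruence)
  with EA AE show ?thesis by blast
qed

section \<open>Sums of squares\<close>

definition quadratic_sos :: "'m::finite mpoly ^ 'n ^ 'n \<Rightarrow> bool" where
  "quadratic_sos S \<longleftrightarrow>
     symmetric_mat S \<and> (\<forall>r s. total_degree (S $ r $ s) \<le> 2) \<and> sos_mat S"

text \<open>The two factors are placed side by side, hence the shift \<open>k - q\<close> in
  \<open>U\<close>.\<close>

lemma sos_mat_add:
  assumes "sos_mat S" "sos_mat S'"
  shows "sos_mat (S + S')"
proof -
  obtain q :: nat and T where T: "\<And>r s. S $ r $ s = (\<Sum>k<q. T r k * T s k)"
    using assms(1) by (auto simp: sos_mat_def)
  obtain q' :: nat and T' where T': "\<And>r s. S' $ r $ s = (\<Sum>k<q'. T' r k * T' s k)"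
    using assms(2) by (auto simp: sos_mat_def)
  define U where "U r k = (if k < q then T r k else T' r (k - q))" for r k
  have split: "(\<Sum>k<q + q'. g k) = (\<Sum>k<q. g k) + (\<Sum>k<q'. g (q + k))" for g :: "nat \<Rightarrow> 'a mpoly"
    by (induction q') (simp_all add: add.assoc)
  have "(S + S') $ r $ s = (\<Sum>k<q + q'. U r k * U s k)" for r s
    by (simp add: U_def T T' split)
  then show ?thesis unfolding sos_mat_def by blast
qed

lemma quadratic_sos_add:
  "quadratic_sos S \<Longrightarrow> quadratic_sos S' \<Longrightarrow> quadratic_sos (S + S')"
  by (auto simp: quadratic_sos_def sos_mat_add total_degree_add_le symmetric_mat_def
      transpose_def vec_eq_iff)

lemma eval_mpoly_mat_add: "eval_mpoly_mat (S + S') \<delta> = eval_mpoly_mat S \<delta> + eval_mpoly_mat S' \<delta>"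
  by (simp add: eval_mpoly_mat_def vec_eq_iff)

text \<open>The form of \<open>T T^T\<close> at \<open>x\<close> is the squared norm of
  \<open>T^T x\<close>.\<close>

lemma psd_eval_sos_mat:
  assumes "sos_mat S"
  shows "psd (eval_mpoly_mat S \<delta>)"
proof -
  obtain q :: nat and T where T: "\<And>r s. S $ r $ s = (\<Sum>k<q. T r k * T s k)"
    using assms by (auto simp: sos_mat_def)
  define t where "t r k = eval_mpoly (T r k) \<delta>" for r k
  have S: "eval_mpoly_mat S \<delta> $ r $ s = (\<Sum>k<q. t r k * t s k)" for r s
    by (simp add: eval_mpoly_mat_def T t_def)
  have "x \<bullet> (eval_mpoly_mat S \<delta> *v x) = (\<Sum>k<q. (\<Sum>r\<in>UNIV. x $ r * t r k)\<^sup>2)" for x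
  proof -
    have "x \<bullet> (eval_mpoly_mat S \<delta> *v x) =
        (\<Sum>r\<in>UNIV. \<Sum>s\<in>UNIV. \<Sum>k<q. (x $ r * t r k) * (x $ s * t s k))"
      by (simp add: inner_vec_def matrix_vector_mult_def S sum_distrib_left sum_distrib_right mult_ac)
    also have "\<dots> = (\<Sum>r\<in>UNIV. \<Sum>k<q. \<Sum>s\<in>UNIV. (x $ r * t r k) * (x $ s * t s k))"
      by (intro sum.cong refl sum.swap)
    also have "\<dots> = (\<Sum>k<q. \<Sum>r\<in>UNIV. \<Sum>s\<in>UNIV. (x $ r * t r k) * (x $ s * t s k))"
      by (rule sum.swap)
    finally show ?thesis by (simp add: power2_eq_square sum_product)
  qed
  moreover have "symmetric_mat (eval_mpoly_mat S \<delta>)"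
    by (simp add: symmetric_mat_def transpose_def vec_eq_iff S mult.commute)
  ultimately show ?thesis by (simp add: psd_def sum_nonneg)
qed

text \<open>Writing \<open>A = C C^T\<close> with \<open>C\<close> constant, the factor
  \<open>T = M C\<close> has degree at most 1, so \<open>T T^T\<close> has degree at most 2.\<close>

lemma quadratic_sos_congruence:
  fixes A :: "real ^ 'n ^ 'n" and M :: "'m::finite mpoly ^ 'n ^ 'n"
  assumes "psd A" "\<And>r l. total_degree (M $ r $ l) \<le> 1"
  shows "\<exists>S. quadratic_sos S \<and>
    (\<forall>\<delta>. eval_mpoly_mat S \<delta> = eval_mpoly_mat M \<delta> ** A ** transpose (eval_mpoly_mat M \<delta>))"
proof -
  obtain q :: nat and c where c: "\<And>i j. A $ i $ j = (\<Sum>k<q. c i k * c j k)"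
    using psd_gram[OF assms(1)] by blast
  define T where "T r k = (\<Sum>l\<in>UNIV. M $ r $ l * const_mpoly (c l k))" for r k
  define S :: "'m mpoly ^ 'n ^ 'n" where "S = (\<chi> r s. \<Sum>k<q. T r k * T s k)"
  have T: "total_degree (T r k) \<le> 1" for r k
    unfolding T_def by (intro total_degree_sum_le total_degree_mult_const_le assms)
  have "total_degree (S $ r $ s) \<le> 2" for r s
    using total_degree_mult_le[OF T T] by (simp add: S_def total_degree_sum_le numeral_2_eq_2)
  moreover have "symmetric_mat S"
    by (simp add: S_def symmetric_mat_def transpose_def vec_eq_iff mult.commute)
  moreover have "sos_mat S" by (auto simp: sos_mat_def S_def)
  moreover have "eval_mpoly_mat S \<delta> = eval_mpoly_mat M \<delta> ** A ** transpose (eval_mpoly_mat M \<delta>)" for \<delta>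
  proof -
    define m where "m r l = eval_mpoly (M $ r $ l) \<delta>" for r l
    have "(\<Sum>k<q. (\<Sum>l\<in>UNIV. m r l * c l k) * (\<Sum>l\<in>UNIV. m s l * c l k)) =
        (\<Sum>l'\<in>UNIV. (\<Sum>l\<in>UNIV. m r l * (\<Sum>k<q. c l k * c l' k)) * m s l')" for r s
    proof -
      have "(\<Sum>k<q. (\<Sum>l\<in>UNIV. m r l * c l k) * (\<Sum>l\<in>UNIV. m s l * c l k)) =
          (\<Sum>k<q. \<Sum>l'\<in>UNIV. \<Sum>l\<in>UNIV. (m r l * c l k) * (m s l' * c l' k))"
        by (intro sum.cong refl, simp only: sum_product, rule sum.swap)
      also have "\<dots> = (\<Sum>l'\<in>UNIV. \<Sum>k<q. \<Sum>l\<in>UNIV. (m r l * c l k) * (m s l' * c l' k))"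
        by (rule sum.swap)
      also have "\<dots> = (\<Sum>l'\<in>UNIV. \<Sum>l\<in>UNIV. \<Sum>k<q. (m r l * c l k) * (m s l' * c l' k))"
        by (intro sum.cong refl sum.swap)
      finally show ?thesis
        by (simp add: sum_distrib_left sum_distrib_right mult_ac)
    qed
    then show ?thesis
      by (simp add: eval_mpoly_mat_def S_def T_def matrix_matrix_mult_def transpose_def vec_eq_iff
          m_def c)
  qed
  ultimately show ?thesis unfolding quadratic_sos_def by blast
qed


section \<open>Reduction modulo the vertices of the square\<close>

lemma matrix_mult_scaleR_left: "(c *\<^sub>R A) ** (B :: real ^ 'n ^ 'm) = c *\<^sub>R (A ** B)"
  by (simp add: matrix_matrix_mult_def vec_eq_iff sum_distrib_left mult_ac)

lemma matrix_mult_scaleR_right: "A ** (c *\<^sub>R (B :: real ^ 'n ^ 'm)) = c *\<^sub>R (A ** B)"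
  by (simp add: matrix_matrix_mult_def vec_eq_iff sum_distrib_left mult_ac)

lemma matrix_add_rdistrib: "(A + B) ** (C :: real ^ 'n ^ 'm) = A ** C + B ** C"
  by (simp add: matrix_matrix_mult_def vec_eq_iff sum.distrib distrib_right)

lemma transpose_add: "transpose (A + B :: real ^ 'n ^ 'm) = transpose A + transpose B"
  by (simp add: transpose_def vec_eq_iff)

text \<open>If \<open>u\<close> and \<open>v\<close> are affine functions of \<open>\<delta>\<close> that satisfy \<open>u\<^sup>2 + v\<^sup>2 = 1\<close> and \<open>u v = 0\<close> at the
  vertices of the cube, then the right-hand side agrees there with \<open>A + u K + v L\<close>.\<close>

lemma quadratic_sos_representation:
  fixes A K L :: "real ^ 'n ^ 'n" and u v :: "'m::finite mpoly"
  assumes A: "psd A"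
    and K: "symmetric_mat K" "psd (A + K)" "psd (A - K)"
    and L: "symmetric_mat L" "psd (A + L)" "psd (A - L)"
    and deg: "total_degree u \<le> 1" "total_degree v \<le> 1"
  shows "\<exists>S X. quadratic_sos S \<and> symmetric_mat X \<and>
    (\<forall>\<delta>. eval_mpoly_mat S \<delta> =
      ((1 + (eval_mpoly u \<delta>)\<^sup>2 + (eval_mpoly v \<delta>)\<^sup>2) / 2) *\<^sub>R A
        + eval_mpoly u \<delta> *\<^sub>R K + eval_mpoly v \<delta> *\<^sub>R L
        + (eval_mpoly u \<delta> * eval_mpoly v \<delta>) *\<^sub>R X)"
proof -
  obtain E where E: "E ** A = K" "A ** transpose E = K" "psd (A - E ** A ** transpose E)"
    using psd_pair_factor[OF A K] by blast
  obtain F where F: "F ** A = L" "A ** transpose F = L" "psd (A - F ** A ** transpose F)"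
    using psd_pair_factor[OF A L] by blast
  \<comment> \<open>\<open>M\<close>, \<open>U\<close>, \<open>V\<close> encode
    \<open>1 + u E + v F\<close>, \<open>u 1\<close> and \<open>v 1\<close>. The last two bring the
    defects of \<open>E\<close> and \<open>F\<close> into congruence form.\<close>
  define M :: "'m mpoly ^ 'n ^ 'n" where
    "M = (\<chi> r l. const_mpoly ((mat 1 :: real ^ 'n ^ 'n) $ r $ l)
        + u * const_mpoly (E $ r $ l) + v * const_mpoly (F $ r $ l))"
  define U :: "'m mpoly ^ 'n ^ 'n" where
    "U = (\<chi> r l. u * const_mpoly ((mat 1 :: real ^ 'n ^ 'n) $ r $ l))"
  define V :: "'m mpoly ^ 'n ^ 'n" where
    "V = (\<chi> r l. v * const_mpoly ((mat 1 :: real ^ 'n ^ 'n) $ r $ l))"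
  have degs: "total_degree (M $ r $ l) \<le> 1" "total_degree (U $ r $ l) \<le> 1"
    "total_degree (V $ r $ l) \<le> 1" for r l
    unfolding M_def U_def V_def using deg
    by (auto intro!: total_degree_add_le total_degree_const_mpoly total_degree_mult_const_le)
  obtain S1 where S1: "quadratic_sos S1"
    "\<And>\<delta>. eval_mpoly_mat S1 \<delta> =
      eval_mpoly_mat M \<delta> ** ((1/2) *\<^sub>R A) ** transpose (eval_mpoly_mat M \<delta>)"
    using quadratic_sos_congruence[OF psd_scaleR[OF A, of "1/2"] degs(1)] by auto
  obtain S2 where S2: "quadratic_sos S2"
    "\<And>\<delta>. eval_mpoly_mat S2 \<delta> = eval_mpoly_mat U \<delta> ** ((1/2) *\<^sub>R (A - E ** A ** transpose E))
      ** transpose (eval_mpoly_mat U \<delta>)"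
    using quadratic_sos_congruence[OF psd_scaleR[OF E(3), of "1/2"] degs(2)] by auto
  obtain S3 where S3: "quadratic_sos S3"
    "\<And>\<delta>. eval_mpoly_mat S3 \<delta> = eval_mpoly_mat V \<delta> ** ((1/2) *\<^sub>R (A - F ** A ** transpose F))
      ** transpose (eval_mpoly_mat V \<delta>)"
    using quadratic_sos_congruence[OF psd_scaleR[OF F(3), of "1/2"] degs(3)] by auto
  \<comment> \<open>Half the coefficient of \<open>u v\<close> in \<open>M A M^T\<close>; its two
    summands are transposes of each other.\<close>
  define X where "X = (1/2) *\<^sub>R (E ** A ** transpose F + F ** A ** transpose E)"
  have "transpose A = A" using A by (simp add: psd_def symmetric_mat_def)
  then have "symmetric_mat X"
    by (simp add: symmetric_mat_def X_def transpose_scalar transpose_add matrix_transpose_mul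
        matrix_mul_assoc add.commute)
  moreover have "quadratic_sos (S1 + S2 + S3)"
    using S1 S2 S3 by (simp add: quadratic_sos_add)
  moreover have "eval_mpoly_mat (S1 + S2 + S3) \<delta> =
      ((1 + (eval_mpoly u \<delta>)\<^sup>2 + (eval_mpoly v \<delta>)\<^sup>2) / 2) *\<^sub>R A
        + eval_mpoly u \<delta> *\<^sub>R K + eval_mpoly v \<delta> *\<^sub>R L
        + (eval_mpoly u \<delta> * eval_mpoly v \<delta>) *\<^sub>R X" for \<delta>
  proof -
    define a where "a = eval_mpoly u \<delta>"
    define b where "b = eval_mpoly v \<delta>"
    have M: "eval_mpoly_mat M \<delta> = mat 1 + a *\<^sub>R E + b *\<^sub>R F"
      by (simp add: eval_mpoly_mat_def M_def vec_eq_iff a_def b_def)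
    have U: "eval_mpoly_mat U \<delta> = a *\<^sub>R mat 1" and V: "eval_mpoly_mat V \<delta> = b *\<^sub>R mat 1"
      by (simp_all add: eval_mpoly_mat_def U_def V_def vec_eq_iff a_def b_def)
    have MA: "(mat 1 + a *\<^sub>R E + b *\<^sub>R F) ** A ** transpose (mat 1 + a *\<^sub>R E + b *\<^sub>R F) =
        A + (2 * a) *\<^sub>R K + (2 * b) *\<^sub>R L + a\<^sup>2 *\<^sub>R (E ** A ** transpose E)
          + b\<^sup>2 *\<^sub>R (F ** A ** transpose F) + (2 * a * b) *\<^sub>R X"
      by (simp add: transpose_add transpose_scalar matrix_add_ldistrib matrix_add_rdistrib
          matrix_mult_scaleR_left matrix_mult_scaleR_right E(1,2) F(1,2) X_def)
         (simp add: vec_eq_iff algebra_simps power2_eq_square)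
    \<comment> \<open>The defect terms cancel \<open>E A E^T\<close> and \<open>F A F^T\<close>,
      leaving \<open>u^2 A\<close> and \<open>v^2 A\<close> in their place, all halved.\<close>
    show ?thesis
      unfolding eval_mpoly_mat_add S1 S2 S3 M U V a_def[symmetric] b_def[symmetric]
      by (simp only: matrix_mult_scaleR_left matrix_mult_scaleR_right MA transpose_scalar
          transpose_mat matrix_mul_lid matrix_mul_rid)
         (simp add: vec_eq_iff algebra_simps power2_eq_square)
  qed
  ultimately show ?thesis by blast
qed

section \<open>Passage between vertices, cube and certificates\<close>

lemma X3_I:
  assumes "quadratic_sos S\<^sub>0" "\<And>i. symmetric_mat (S i)"
    and "\<And>\<delta>. G \<delta> = eval_mpoly_mat S\<^sub>0 \<delta> + (\<Sum>i\<in>UNIV. (1 - (\<delta> $ i)\<^sup>2) *\<^sub>R S i)"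
  shows "(S\<^sub>0, S) \<in> X3 G"
  using assms unfolding X3_def quadratic_sos_def by blast

text \<open>For each fixed \<open>x\<close> the form is affine in \<delta>, so its minimum over the
  cube is attained at a vertex.\<close>

lemma psd_cube_of_vertices:
  fixes H\<^sub>0 :: "real ^ 'n ^ 'n" and H :: "'m::finite \<Rightarrow> real ^ 'n ^ 'n"
  assumes "symmetric_mat H\<^sub>0" "\<And>i. symmetric_mat (H i)"
    and vert: "\<And>\<delta> :: real ^ 'm. (\<And>i. \<bar>\<delta> $ i\<bar> = 1) \<Longrightarrow> psd (H\<^sub>0 + (\<Sum>i\<in>UNIV. (\<delta> $ i) *\<^sub>R H i))"
    and \<delta>: "\<And>i. \<bar>\<delta> $ i\<bar> \<le> 1"
  shows "psd (H\<^sub>0 + (\<Sum>i\<in>UNIV. (\<delta> $ i) *\<^sub>R H i))"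
proof -
  have form: "x \<bullet> ((H\<^sub>0 + (\<Sum>i\<in>UNIV. (\<epsilon> $ i) *\<^sub>R H i)) *v x) =
      x \<bullet> (H\<^sub>0 *v x) + (\<Sum>i\<in>UNIV. \<epsilon> $ i * (x \<bullet> (H i *v x)))" for \<epsilon> x
  proof -
    have "(\<Sum>i\<in>I. (\<epsilon> $ i) *\<^sub>R H i) *v x = (\<Sum>i\<in>I. (\<epsilon> $ i) *\<^sub>R (H i *v x))" for I
      by (induction I rule: infinite_finite_induct)
         (simp_all add: matrix_vector_mult_add_rdistrib scaleR_matrix_vector_assoc)
    then show ?thesis
      by (simp add: matrix_vector_mult_add_rdistrib inner_add_right inner_sum_right)
  qed
  have "0 \<le> x \<bullet> ((H\<^sub>0 + (\<Sum>i\<in>UNIV. (\<delta> $ i) *\<^sub>R H i)) *v x)" for x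
  proof -
    \<comment> \<open>The vertex minimizing every summand for this \<open>x\<close>: each sign
      opposes its coefficient.\<close>
    define \<epsilon> :: "real ^ 'm" where "\<epsilon> = (\<chi> i. if 0 \<le> x \<bullet> (H i *v x) then -1 else 1)"
    have "0 \<le> x \<bullet> ((H\<^sub>0 + (\<Sum>i\<in>UNIV. (\<epsilon> $ i) *\<^sub>R H i)) *v x)"
      using vert[of \<epsilon>] by (simp add: psd_def \<epsilon>_def)
    also have "\<dots> \<le> x \<bullet> ((H\<^sub>0 + (\<Sum>i\<in>UNIV. (\<delta> $ i) *\<^sub>R H i)) *v x)"
    proof -
      have "\<epsilon> $ i * (x \<bullet> (H i *v x)) \<le> \<delta> $ i * (x \<bullet> (H i *v x))" for i
      proof (cases "0 \<le> x \<bullet> (H i *v x)")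
        case True
        then show ?thesis
          using \<delta>[of i] mult_right_mono[of "-1" "\<delta> $ i"] by (simp add: \<epsilon>_def abs_le_iff)
      next
        case False
        then show ?thesis
          using \<delta>[of i] mult_right_mono_neg[of "\<delta> $ i" 1] by (simp add: \<epsilon>_def abs_le_iff)
      qed
      then show ?thesis unfolding form by (simp add: sum_mono)
    qed
    finally show ?thesis .
  qed
  moreover have "symmetric_mat (\<Sum>i\<in>I. (\<delta> $ i) *\<^sub>R H i)" for I
    by (induction I rule: infinite_finite_induct)
       (simp_all add: symmetric_mat_add symmetric_mat_scaleR assms,
        simp_all add: symmetric_mat_def transpose_def vec_eq_iff)
  ultimately show ?thesis
    by (simp add: psd_def symmetric_mat_add assms(1))
qed

text \<open>The \<open>S i\<close> are read off by expanding the difference between \<open>G\<close>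
  and the sum of squares in the polynomials \<open>1 - \<delta>_i^2\<close>.\<close>

lemma X3_nonempty_of_psd:
  fixes H\<^sub>0 :: "real ^ 'n ^ 'n" and H :: "'m::finite \<Rightarrow> real ^ 'n ^ 'n"
  assumes m: "CARD('m) \<in> {1, 2}"
    and sym: "symmetric_mat H\<^sub>0" "\<And>i. symmetric_mat (H i)"
    and G: "\<And>\<delta>. G \<delta> = H\<^sub>0 + (\<Sum>i\<in>UNIV. (\<delta> $ i) *\<^sub>R H i)"
    and psd: "\<And>\<delta>. (\<And>i. \<bar>\<delta> $ i\<bar> \<le> 1) \<Longrightarrow> psd (G \<delta>)"
  shows "\<exists>S\<^sub>0 S. (S\<^sub>0, S) \<in> X3 G"
proof -
  have H0: "psd H\<^sub>0" using psd[of 0] by (simp add: G)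
  consider (one) i where "(UNIV :: 'm set) = {i}"
    | (two) i j where "(UNIV :: 'm set) = {i, j}" "i \<noteq> j"
    using m by (auto simp: card_1_singleton_iff card_2_iff)
  then show ?thesis
  proof cases
    case one
    have "psd (H\<^sub>0 + H i)" using psd[of "\<chi> k. 1"] by (simp add: G one)
    moreover have "psd (H\<^sub>0 - H i)" using psd[of "\<chi> k. -1"] by (simp add: G one)
    moreover have "symmetric_mat (0 :: real ^ 'n ^ 'n)"
      by (simp add: symmetric_mat_def transpose_def vec_eq_iff)
    \<comment> \<open>Here \<open>L = 0\<close> and \<open>v = 0\<close>, so the conditions on
      \<open>L\<close> reduce to \<open>psd H\<^sub>0\<close> and the \<open>X\<close> term
      vanishes.\<close>
    ultimately obtain S X where S: "quadratic_sos S"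
      "\<And>\<delta>. eval_mpoly_mat S \<delta> = ((1 + (\<delta> $ i)\<^sup>2) / 2) *\<^sub>R H\<^sub>0 + (\<delta> $ i) *\<^sub>R H i"
      using quadratic_sos_representation[OF H0 sym(2)[of i], of 0 "var_mpoly i" 0] H0
      by (auto simp: total_degree_zero_le total_degree_var_mpoly simp del: One_nat_def)
    \<comment> \<open>The multiplier comes from
      \<open>1 - (1 + \<delta>_i^2) / 2 = (1 - \<delta>_i^2) / 2\<close>.\<close>
    have "(S, \<lambda>_. (1/2) *\<^sub>R H\<^sub>0) \<in> X3 G"
      by (rule X3_I[OF S(1)])
         (simp add: symmetric_mat_scaleR sym, simp add: G S one vec_eq_iff field_simps)
    then show ?thesis by blast
  next
    case two
    have sum: "(\<Sum>k\<in>UNIV. f k) = f i + f j" for f :: "'m \<Rightarrow> real ^ 'n ^ 'n"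
      unfolding two(1) using two(2) by simp
    have ne: "j \<noteq> i" using two by simp
    \<comment> \<open>\<open>u K + v L = \<delta>_i H_i + \<delta>_j H_j\<close>, and the four
      vertex values of \<open>G\<close> are \<open>H\<^sub>0\<close> plus or minus \<open>K\<close>
      or \<open>L\<close>.\<close>
    define K where "K = H i + H j"
    define L where "L = H i - H j"
    define u where "u = (var_mpoly i + var_mpoly j) * const_mpoly (1/2)"
    define v where "v = (var_mpoly i + var_mpoly j * const_mpoly (-1)) * const_mpoly (1/2)"
    have "psd (H\<^sub>0 + K)"
      using psd[of "\<chi> k. 1"] ne by (simp add: G sum K_def algebra_simps)
    moreover have "psd (H\<^sub>0 - K)"
      using psd[of "\<chi> k. -1"] ne by (simp add: G sum K_def algebra_simps)
    moreover have "psd (H\<^sub>0 + L)"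
      using psd[of "\<chi> k. if k = i then 1 else -1"] ne by (simp add: G sum L_def algebra_simps)
    moreover have "psd (H\<^sub>0 - L)"
      using psd[of "\<chi> k. if k = i then -1 else 1"] ne by (simp add: G sum L_def algebra_simps)
    moreover have "symmetric_mat K" "symmetric_mat L"
      by (simp_all add: K_def L_def symmetric_mat_add symmetric_mat_diff sym)
    moreover have "total_degree u \<le> 1" "total_degree v \<le> 1"
      unfolding u_def v_def
      by (intro total_degree_mult_const_le total_degree_add_le total_degree_var_mpoly)+
    ultimately obtain S X where S: "quadratic_sos S" and X: "symmetric_mat X"
      and eval: "\<And>\<delta>. eval_mpoly_mat S \<delta> =
        ((1 + (eval_mpoly u \<delta>)\<^sup>2 + (eval_mpoly v \<delta>)\<^sup>2) / 2) *\<^sub>R H\<^sub>0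
          + eval_mpoly u \<delta> *\<^sub>R K + eval_mpoly v \<delta> *\<^sub>R L
          + (eval_mpoly u \<delta> * eval_mpoly v \<delta>) *\<^sub>R X"
      using quadratic_sos_representation[OF H0] by metis
    have uv: "eval_mpoly u \<delta> = (\<delta> $ i + \<delta> $ j) / 2" "eval_mpoly v \<delta> = (\<delta> $ i - \<delta> $ j) / 2" for \<delta>
      by (simp_all add: u_def v_def)
    \<comment> \<open>Since \<open>u^2 + v^2 = (\<delta>_i^2 + \<delta>_j^2) / 2\<close>, the
      \<open>H\<^sub>0\<close> defect splits equally. Since
      \<open>- u v = ((1 - \<delta>_i^2) - (1 - \<delta>_j^2)) / 4\<close>, the \<open>X\<close>
      term enters with opposite signs.\<close>
    define T where "T k = (1/4) *\<^sub>R H\<^sub>0 + (if k = i then 1/4 else -1/4) *\<^sub>R X" for k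
    have "symmetric_mat (T k)" for k
      by (simp add: T_def symmetric_mat_add symmetric_mat_scaleR sym X)
    moreover have "G \<delta> = eval_mpoly_mat S \<delta> + (\<Sum>k\<in>UNIV. (1 - (\<delta> $ k)\<^sup>2) *\<^sub>R T k)" for \<delta>
      using ne
      by (simp add: G eval uv sum T_def K_def L_def vec_eq_iff field_simps power2_eq_square)
    ultimately have "(S, T) \<in> X3 G" by (rule X3_I[OF S])
    then show ?thesis by blast
  qed
qed

theorem theorem14:
  fixes H\<^sub>0 :: "real ^ 'n ^ 'n"
    and H :: "'m::finite \<Rightarrow> real ^ 'n ^ 'n"
    and G :: "real ^ 'm \<Rightarrow> real ^ 'n ^ 'n"
  assumes "CARD('m) \<in> {1, 2}"
    and "symmetric_mat H\<^sub>0"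
    and "\<And>i. symmetric_mat (H i)"
    and "\<And>\<delta>. G \<delta> = H\<^sub>0 + (\<Sum>i\<in>UNIV. (\<delta> $ i) *\<^sub>R H i)"
  shows "(\<forall>\<delta> \<in> {\<delta> :: real ^ 'm. \<forall>i. \<bar>\<delta> $ i\<bar> \<le> 1}. psd (G \<delta>))
    \<longleftrightarrow> (\<exists>S\<^sub>0 S. (S\<^sub>0, S) \<in> X3 G)"
proof
  assume "\<forall>\<delta> \<in> {\<delta> :: real ^ 'm. \<forall>i. \<bar>\<delta> $ i\<bar> \<le> 1}. psd (G \<delta>)"
  then show "\<exists>S\<^sub>0 S. (S\<^sub>0, S) \<in> X3 G"
    using X3_nonempty_of_psd[OF assms] by blast
next
  assume "\<exists>S\<^sub>0 S. (S\<^sub>0, S) \<in> X3 G"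
  then obtain S\<^sub>0 S where sos: "sos_mat S\<^sub>0"
    and eq: "\<And>\<delta>. G \<delta> = eval_mpoly_mat S\<^sub>0 \<delta> + (\<Sum>i\<in>UNIV. (1 - (\<delta> $ i)\<^sup>2) *\<^sub>R S i)"
    unfolding X3_def by blast
  \<comment> \<open>The \<open>S i\<close> may be indefinite, so the representation yields
    positivity directly only at vertices; \<open>psd_cube_of_vertices\<close> then extends it to the
    cube.\<close>
  have "psd (H\<^sub>0 + (\<Sum>i\<in>UNIV. (\<delta> $ i) *\<^sub>R H i))" if "\<And>i. \<bar>\<delta> $ i\<bar> = 1" for \<delta> :: "real ^ 'm"
  proof -
    have "(\<delta> $ i)\<^sup>2 = 1" for i using that[of i] by (metis power2_abs one_power2)
    then have "G \<delta> = eval_mpoly_mat S\<^sub>0 \<delta>" by (simp add: eq)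
    then show ?thesis using psd_eval_sos_mat[OF sos, of \<delta>] assms(4) by simp
  qed
  then show "\<forall>\<delta> \<in> {\<delta> :: real ^ 'm. \<forall>i. \<bar>\<delta> $ i\<bar> \<le> 1}. psd (G \<delta>)"
    using psd_cube_of_vertices[of H\<^sub>0 H, OF assms(2,3)] assms(4) by auto
qed

end
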